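(* For every composition $\alpha=[\alpha_1,\dots,\alpha_\ell]$ and every positive integer $k$, \[{\mathfrak S}_\alpha\Psi_k=\sum_{j=1}^{\ell}{\mathfrak S}_{[\alpha_1,\dots,\alpha_{j-1},\alpha_j+k,\alpha_{j+1},\dots,\alpha_\ell]}+\sum_{j=0}^{k-1}{\mathfrak S}_{[\alpha_1,\dots,\alpha_\ell,\underbrace{0,\dots,0}_{j},k]}.\]
   Context: Work over $\mathbb{Q}$. A composition is a finite sequence of positive integers. $\mathsf{NSym}$ is the free associative $\mathbb{Q}$-algebra on $H_1,H_2,\dots$ ($\deg H_i=i$); $H_{(a_1,\dots,a_m)}=H_{a_1}\cdots H_{a_m}$, $H_0=1$, $H_{-r}=0$ for $r>0$. $\mathsf{QSym}$ has monomial basis $M_\alpha=\sum_{i_1<\dots<i_m}x_{i_1}^{\alpha_1}\cdots x_{i_m}^{\alpha_m}$, paired with $\mathsf{NSym}$ by $\langle H_\alpha,M_\beta\rangle=\delta_{\alpha,\beta}$; $F^\perp$ is defined by $\langle F^\perp H,G\rangle=\langle H,FG\rangle$ for all $G\in\mathsf{QSym}$. With $D(\alpha)=\{\alpha_1,\dots,\alpha_1+\dots+\alpha_{m-1}\}$ and $\alpha\le\beta$ iff $D(\beta)\subseteq D(\alpha)$, $F_\alpha=\sum_{\beta\le\alpha}M_\beta$, $F_{1^i}=F_{(1,\dots,1)}$ ($i$ ones, $F_{1^0}=1$). $\mathbb{B}_m=\sum_{i\ge0}(-1)^iH_{m+i}F_{1^i}^\perp$ (for any integer $m$), and for any integer tuple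 $\gamma=(\gamma_1,\dots,\gamma_r)\in\mathbb{Z}^r$ (zeros allowed), ${\mathfrak S}_\gamma=\mathbb{B}_{\gamma_1}\cdots\mathbb{B}_{\gamma_r}(1)$. The noncommutative power sums $\Psi_k$ (of the first kind, Gelfand–Krob–Lascoux–Leclerc–Retakh–Thibon) are defined by $\frac{d}{dt}\sigma(t)=\sigma(t)\psi(t)$ where $\sigma(t)=\sum_{n\ge0}H_nt^n$ and $\psi(t)=\sum_{k\ge1}\Psi_kt^{k-1}$; equivalently $\Psi_k=\sum_{i=0}^{k-1}(-1)^iR_{(1^i,k-i)}$, where $R_\beta=\sum_{\gamma\ge\beta}(-1)^{\ell(\beta)-\ell(\gamma)}H_\gamma$ are the ribbon functions. *)

theory Defs
  imports
    "HOL-Library.Poly_Mapping"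
    "HOL-Computational_Algebra.Formal_Power_Series"
begin

section \<open>Compositions\<close>

typedef composition = "{a :: nat list. 0 \<notin> set a}"
  morphisms parts Composition
  by (rule exI[of _ "[]"]) simp

setup_lifting type_definition_composition

lemma parts_pos: "0 \<notin> set (parts a)"
  using parts by blast

text \<open>Concatenation, written additively so that the convolution product of
  \<^theory>\<open>HOL-Library.Poly_Mapping\<close> applies. The compositions are the free monoid
  on the positive integers.\<close>

instantiation composition :: monoid_add
begin

lift_definition zero_composition :: composition is "[]" by simp

lift_definition plus_composition :: "composition \<Rightarrow> composition \<Rightarrow> composition" is "(@)"
  by simp

instance by standard (transfer, simp)+

end

lift_definition ones :: "nat \<Rightarrow> composition" is "\<lambda>i. replicate i 1"
  by simp

definition size_comp :: "composition \<Rightarrow> nat" where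
  "size_comp a = sum_list (parts a)"

definition descents :: "composition \<Rightarrow> nat set" where
  "descents a = {sum_list (take j (parts a)) | j. 1 \<le> j \<and> j < length (parts a)}"

text \<open>The order compares only compositions of the same integer.\<close>

definition comp_le :: "composition \<Rightarrow> composition \<Rightarrow> bool" where
  "comp_le a b \<longleftrightarrow> size_comp a = size_comp b \<and> descents b \<subseteq> descents a"

section \<open>NSym\<close>

text \<open>The free associative algebra on \<open>H\<^sub>1, H\<^sub>2, \<dots>\<close> is the monoid algebra of the free
  monoid of compositions; its unit is the basis element of the empty composition.\<close>

type_synonym nsym = "composition \<Rightarrow>\<^sub>0 rat"

definition H_comp :: "composition \<Rightarrow> nsym" where
  "H_comp a = Poly_Mapping.single a 1"

definition H :: "int \<Rightarrow> nsym" where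
  "H n = (if n < 0 then 0 else if n = 0 then 1 else H_comp (Composition [nat n]))"

lemma H_comp_eq_prod: "H_comp a = prod_list (map (\<lambda>i. H (int i)) (parts a))"
proof -
  have "0 \<notin> set xs \<Longrightarrow> H_comp (Composition xs) = prod_list (map (\<lambda>i. H (int i)) xs)" for xs
  proof (induction xs)
    case Nil
    then show ?case by (simp add: H_comp_def zero_composition_def[symmetric])
  next
    case (Cons x xs)
    have "Composition (x # xs) = Composition [x] + Composition xs"
      using Cons.prems by (simp add: plus_composition_def Composition_inverse)
    then have "H_comp (Composition (x # xs)) = H_comp (Composition [x]) * H_comp (Composition xs)"
      by (simp add: H_comp_def mult_single)
    with Cons show ?case by (auto simp: H_def)
  qed
  from this[OF parts_pos] show ?thesis by (simp add: parts_inverse)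
qed

section \<open>QSym\<close>

text \<open>Power series in countably many commuting variables \<open>x\<^sub>0, x\<^sub>1, \<dots>\<close>, given by their
  coefficients; monomials are exponent vectors.\<close>

type_synonym pseries = "(nat \<Rightarrow>\<^sub>0 nat) \<Rightarrow> rat"

definition ps_mult :: "pseries \<Rightarrow> pseries \<Rightarrow> pseries" (infixl \<open>\<star>\<close> 70) where
  "(F \<star> G) e = (\<Sum>(a, b) \<in> {(a, b). a + b = e}. F a * G b)"

definition mono_at :: "nat list \<Rightarrow> nat list \<Rightarrow> (nat \<Rightarrow>\<^sub>0 nat)" where
  "mono_at is a = (\<Sum>j < length a. Poly_Mapping.single (is ! j) (a ! j))"

text \<open>The coefficient of a monomial in \<open>M\<^sub>\<alpha>\<close> is the number of summands equal to it.\<close>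

definition M :: "composition \<Rightarrow> pseries" where
  "M a e = of_nat (card {is. length is = length (parts a) \<and> sorted_wrt (<) is
                            \<and> mono_at is (parts a) = e})"

definition QSym :: "pseries set" where
  "QSym = {\<lambda>e. \<Sum>a\<in>A. c a * M a e | A c. finite A}"

definition Fund :: "composition \<Rightarrow> pseries" where
  "Fund a e = (\<Sum>b | comp_le b a. M b e)"

section \<open>The pairing\<close>

text \<open>The coefficient of \<open>M\<^sub>\<alpha>\<close> in a quasisymmetric function is its coefficient at
  \<open>x\<^sub>0\<^bsup>\<alpha>\<^sub>1\<^esup> x\<^sub>1\<^bsup>\<alpha>\<^sub>2\<^esup> \<dots>\<close>. The lemmas below show that the resulting form is the bilinear one
  with \<open>\<langle>H\<^sub>\<alpha>, M\<^sub>\<beta>\<rangle> = \<delta>\<close>.\<close>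

definition packed :: "composition \<Rightarrow> (nat \<Rightarrow>\<^sub>0 nat)" where
  "packed a = mono_at [0..<length (parts a)] (parts a)"

definition pairing :: "nsym \<Rightarrow> pseries \<Rightarrow> rat" where
  "pairing X G = (\<Sum>a \<in> Poly_Mapping.keys X. Poly_Mapping.lookup X a * G (packed a))"

definition perp :: "pseries \<Rightarrow> nsym \<Rightarrow> nsym" where
  "perp F X = (THE Y. \<forall>G\<in>QSym. pairing Y G = pairing X (F \<star> G))"

section \<open>Creation operators and immaculate functions\<close>

text \<open>\<^const>\<open>Sum_any\<close> sums over the finite support; see \<open>finite_perp_ones\<close> below.\<close>

definition BB :: "int \<Rightarrow> nsym \<Rightarrow> nsym" where
  "BB m X = Sum_any (\<lambda>i. (-1) ^ i * H (m + int i) * perp (Fund (ones i)) X)"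

definition immaculate :: "int list \<Rightarrow> nsym" where
  "immaculate g = foldr BB g 1"

section \<open>Noncommutative power sums of the first kind\<close>

definition sigma :: "nsym fps" where
  "sigma = Abs_fps (\<lambda>n. H (int n))"

definition psi :: "nsym fps" where
  "psi = (THE p. fps_deriv sigma = sigma * p)"

definition Psi :: "nat \<Rightarrow> nsym" where
  "Psi k = fps_nth psi (k - 1)"

section \<open>The definitions are meaningful\<close>

lemma psi_ex1: "\<exists>!p. fps_deriv sigma = sigma * p"
proof
  have s0: "fps_nth sigma 0 = 1" by (simp add: sigma_def H_def)
  have R: "sigma * fps_right_inverse sigma 1 = 1"
    by (rule fps_right_inverse) (simp add: s0)
  have L: "fps_left_inverse sigma 1 * sigma = 1"
    by (rule fps_left_inverse) (simp add: s0)
  show "fps_deriv sigma = sigma * (fps_right_inverse sigma 1 * fps_deriv sigma)"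
    by (simp only: mult.assoc[symmetric] R mult_1_left)
  show "p = fps_right_inverse sigma 1 * fps_deriv sigma" if "fps_deriv sigma = sigma * p" for p
  proof -
    have "p = fps_left_inverse sigma 1 * (sigma * p)"
      by (simp only: mult.assoc[symmetric] L mult_1_left)
    also have "\<dots> = fps_left_inverse sigma 1 *
        (sigma * (fps_right_inverse sigma 1 * fps_deriv sigma))"
      by (simp only: that[symmetric] mult.assoc[symmetric] R mult_1_left)
    also have "\<dots> = fps_right_inverse sigma 1 * fps_deriv sigma"
      by (simp only: mult.assoc[symmetric] L mult_1_left)
    finally show ?thesis .
  qed
qed

lemma psi_deriv: "fps_deriv sigma = sigma * psi"
  unfolding psi_def by (rule theI'[OF psi_ex1])

lemma lookup_mono_at:
  assumes "distinct is" "length is = length a"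
  shows "j < length a \<Longrightarrow> Poly_Mapping.lookup (mono_at is a) (is ! j) = a ! j"
    and "v \<notin> set is \<Longrightarrow> Poly_Mapping.lookup (mono_at is a) v = 0"
proof -
  show "Poly_Mapping.lookup (mono_at is a) (is ! j) = a ! j" if "j < length a"
  proof -
    have "Poly_Mapping.lookup (mono_at is a) (is ! j) = (\<Sum>k<length a. if k = j then a ! k else 0)"
      unfolding mono_at_def lookup_sum
      by (rule sum.cong) (use assms that in \<open>auto simp: lookup_single when_def nth_eq_iff_index_eq\<close>)
    with that show ?thesis by simp
  qed
  show "Poly_Mapping.lookup (mono_at is a) v = 0" if "v \<notin> set is"
    unfolding mono_at_def lookup_sum
    by (rule sum.neutral) (use assms that in \<open>auto simp: lookup_single when_def\<close>)
qed

lemma keys_mono_at: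
  assumes "distinct is" "length is = length (parts a)"
  shows "Poly_Mapping.keys (mono_at is (parts a)) = set is"
proof -
  have "Poly_Mapping.lookup (mono_at is (parts a)) v \<noteq> 0 \<longleftrightarrow> v \<in> set is" for v
    using lookup_mono_at[OF assms] parts_pos[of a] assms
    by (metis in_set_conv_nth)
  then show ?thesis by (auto simp: in_keys_iff)
qed

lemma mono_at_inject:
  assumes "sorted_wrt (<) is" "sorted_wrt (<) js"
    and "length is = length (parts a)" "length js = length (parts b)"
    and eq: "mono_at is (parts a) = mono_at js (parts b)"
  shows "is = js \<and> a = b"
proof
  have d: "distinct is" "distinct js" using assms(1,2) by (auto simp: strict_sorted_iff)
  have "set is = set js" using keys_mono_at[OF d(1) assms(3)] keys_mono_at[OF d(2) assms(4)] eq by simp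
  then show "is = js" using assms(1,2) by (simp add: strict_sorted_equal)
  then have "parts a = parts b"
    using lookup_mono_at(1)[OF d(1) assms(3)] lookup_mono_at(1)[OF d(2) assms(4)] assms(3,4) eq
    by (metis nth_equalityI)
  then show "a = b" by (simp add: parts_inject)
qed

lemma M_packed: "M b (packed a) = (if a = b then 1 else 0)"
proof -
  have sr: "sorted_wrt (<) [0..<length (parts a)]" by simp
  have "{is. length is = length (parts b) \<and> sorted_wrt (<) is \<and> mono_at is (parts b) = packed a}
      = (if a = b then {[0..<length (parts a)]} else {})"
    using mono_at_inject[OF _ sr, of _ b a] by (auto simp: packed_def)
  then show ?thesis by (simp add: M_def)
qed

lemma pairing_H_M: "pairing (H_comp a) (M b) = (if a = b then 1 else 0)"
  by (simp add: pairing_def H_comp_def M_packed)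

lemma pairing_superset:
  assumes "finite S" "Poly_Mapping.keys X \<subseteq> S"
  shows "pairing X G = (\<Sum>a\<in>S. Poly_Mapping.lookup X a * G (packed a))"
  unfolding pairing_def by (rule sum.mono_neutral_left) (use assms in \<open>auto simp: in_keys_iff\<close>)

lemma pairing_add_left: "pairing (X + Y) G = pairing X G + pairing Y G"
proof -
  let ?S = "Poly_Mapping.keys X \<union> Poly_Mapping.keys Y"
  have "Poly_Mapping.keys (X + Y) \<subseteq> ?S" by (rule Poly_Mapping.keys_add)
  then show ?thesis
    by (simp add: pairing_superset[of ?S] lookup_add sum.distrib algebra_simps)
qed

lemma pairing_sum_right:
  "pairing X (\<lambda>e. \<Sum>a\<in>A. c a * G a e) = (\<Sum>a\<in>A. c a * pairing X (G a))"
proof -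
  have "pairing X (\<lambda>e. \<Sum>a\<in>A. c a * G a e)
      = (\<Sum>b\<in>Poly_Mapping.keys X. \<Sum>a\<in>A. c a * (Poly_Mapping.lookup X b * G a (packed b)))"
    unfolding pairing_def sum_distrib_left by (intro sum.cong refl) simp
  also have "\<dots> = (\<Sum>a\<in>A. \<Sum>b\<in>Poly_Mapping.keys X. c a * (Poly_Mapping.lookup X b * G a (packed b)))"
    by (rule sum.swap)
  finally show ?thesis by (simp add: pairing_def sum_distrib_left)
qed

lemma pairing_M: "pairing X (M a) = Poly_Mapping.lookup X a"
proof -
  have "pairing X (M a) = (\<Sum>b\<in>Poly_Mapping.keys X. if b = a then Poly_Mapping.lookup X b else 0)"
    unfolding pairing_def by (intro sum.cong refl) (simp add: M_packed)
  also have "\<dots> = Poly_Mapping.lookup X a" by (simp add: in_keys_iff)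
  finally show ?thesis .
qed

lemma M_in_QSym: "M a \<in> QSym"
  unfolding QSym_def by (auto intro!: exI[of _ "{a}"] exI[of _ "\<lambda>_. 1"])

lemma finite_divisors: "finite {(a, b :: nat \<Rightarrow>\<^sub>0 nat). a + b = e}"
proof -
  let ?B = "{f. \<forall>v. (v \<in> Poly_Mapping.keys e \<longrightarrow> f v \<in> {..Max (range (Poly_Mapping.lookup e))}) \<and> (v \<notin> Poly_Mapping.keys e \<longrightarrow> f v = 0)}"
  have fr: "finite (range (Poly_Mapping.lookup e))"
    by (rule finite_subset[of _ "insert 0 (Poly_Mapping.lookup e ` Poly_Mapping.keys e)"]) (auto simp: in_keys_iff)
  have fB: "finite ?B" by (rule finite_set_of_finite_funs) auto
  have le: "Poly_Mapping.lookup a v \<le> Poly_Mapping.lookup e v \<and> Poly_Mapping.lookup b v \<le> Poly_Mapping.lookup e v" if "a + b = e" for a b :: "nat \<Rightarrow>\<^sub>0 nat" and v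
    using that by (auto simp: lookup_add)
  have mem: "Poly_Mapping.lookup c \<in> ?B" if "\<And>v. Poly_Mapping.lookup c v \<le> Poly_Mapping.lookup e v" for c :: "nat \<Rightarrow>\<^sub>0 nat"
  proof -
    have "Poly_Mapping.lookup c v \<le> Max (range (Poly_Mapping.lookup e))" for v
      using that[of v] Max_ge[OF fr, of "Poly_Mapping.lookup e v"] by (simp add: order_trans)
    moreover have "Poly_Mapping.lookup c v = 0" if "Poly_Mapping.lookup e v = 0" for v
      using \<open>\<And>v. Poly_Mapping.lookup c v \<le> Poly_Mapping.lookup e v\<close>[of v] that by simp
    ultimately show ?thesis by (simp add: in_keys_iff)
  qed
  have "map_prod Poly_Mapping.lookup Poly_Mapping.lookup ` {(a, b). a + b = e} \<subseteq> ?B \<times> ?B"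
  proof (rule image_subsetI)
    fix p :: "(nat \<Rightarrow>\<^sub>0 nat) \<times> (nat \<Rightarrow>\<^sub>0 nat)"
    assume "p \<in> {(a, b). a + b = e}"
    then have "fst p + snd p = e" by auto
    note * = le[OF this]
    have "Poly_Mapping.lookup (fst p) \<in> ?B" by (rule mem) (rule conjunct1[OF *])
    moreover have "Poly_Mapping.lookup (snd p) \<in> ?B" by (rule mem) (rule conjunct2[OF *])
    ultimately show "map_prod Poly_Mapping.lookup Poly_Mapping.lookup p \<in> ?B \<times> ?B"
      by (simp only: map_prod_def case_prod_unfold mem_Times_iff fst_conv snd_conv simp_thms)
  qed
  then have "finite (map_prod Poly_Mapping.lookup Poly_Mapping.lookup ` {(a, b). a + b = e})"
    using finite_cartesian_product[OF fB fB] by (rule finite_subset)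
  then show ?thesis
    by (rule finite_imageD) (auto simp: inj_on_def lookup_inject)
qed

lemma ps_mult_nz:
  assumes "(F \<star> G) e \<noteq> 0"
  obtains a b where "a + b = e" "F a \<noteq> 0" "G b \<noteq> 0"
proof -
  have "\<exists>p\<in>{(a, b). a + b = e}. (case p of (a, b) \<Rightarrow> F a * G b) \<noteq> 0"
    using assms unfolding ps_mult_def by (meson sum.not_neutral_contains_not_neutral)
  with that show ?thesis by auto
qed

lemma M_nz:
  assumes "M a e \<noteq> 0"
  obtains "is" where "length is = length (parts a)" "sorted_wrt (<) is" "mono_at is (parts a) = e"
proof -
  let ?I = "{is. length is = length (parts a) \<and> sorted_wrt (<) is \<and> mono_at is (parts a) = e}"
  have "?I \<noteq> {}" using assms unfolding M_def by (metis card.empty of_nat_0)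
  with that show ?thesis by blast
qed

lemma M_disjoint:
  assumes "M a e \<noteq> 0" "M b e \<noteq> 0"
  shows "a = b"
proof -
  obtain "is" where i: "length is = length (parts a)" "sorted_wrt (<) is" "mono_at is (parts a) = e"
    using assms(1) by (rule M_nz)
  obtain js where j: "length js = length (parts b)" "sorted_wrt (<) js" "mono_at js (parts b) = e"
    using assms(2) by (rule M_nz)
  from mono_at_inject[OF i(2) j(2) i(1) j(1)] i(3) j(3) show ?thesis by simp
qed

lemma ps_mult_sum_right:
  "F \<star> (\<lambda>e. \<Sum>a\<in>A. c a * G a e) = (\<lambda>e. \<Sum>a\<in>A. c a * (F \<star> G a) e)"
proof
  fix e
  have "(F \<star> (\<lambda>e. \<Sum>a\<in>A. c a * G a e)) e
      = (\<Sum>p\<in>{(a, b). a + b = e}. \<Sum>a\<in>A. c a * (F (fst p) * G a (snd p)))"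
    unfolding ps_mult_def by (intro sum.cong refl) (auto simp: sum_distrib_left intro!: sum.cong)
  also have "\<dots> = (\<Sum>a\<in>A. \<Sum>p\<in>{(a, b). a + b = e}. c a * (F (fst p) * G a (snd p)))"
    by (rule sum.swap)
  also have "\<dots> = (\<Sum>a\<in>A. c a * (F \<star> G a) e)"
    unfolding ps_mult_def by (intro sum.cong refl) (auto simp: sum_distrib_left intro!: sum.cong)
  finally show "(F \<star> (\<lambda>e. \<Sum>a\<in>A. c a * G a e)) e = (\<Sum>a\<in>A. c a * (F \<star> G a) e)" .
qed

lemma finite_pairing_support: "finite {a. pairing X (F \<star> M a) \<noteq> 0}"
proof -
  let ?D = "\<Union>x\<in>Poly_Mapping.keys X. snd ` {(d, b). d + b = packed x}"
  have fD: "finite ?D" using finite_divisors by auto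
  let ?g = "\<lambda>a. SOME b. b \<in> ?D \<and> M a b \<noteq> 0"
  let ?S = "{a. pairing X (F \<star> M a) \<noteq> 0}"
  have g: "?g a \<in> ?D \<and> M a (?g a) \<noteq> 0" if a: "a \<in> ?S" for a
  proof (rule someI_ex)
    obtain x where x: "x \<in> Poly_Mapping.keys X" "(F \<star> M a) (packed x) \<noteq> 0"
      using a unfolding pairing_def mem_Collect_eq
      by (metis (no_types, lifting) mult_zero_right sum.neutral)
    from ps_mult_nz[OF x(2)] obtain d b where "d + b = packed x" "M a b \<noteq> 0" by metis
    then show "\<exists>b. b \<in> ?D \<and> M a b \<noteq> 0" using x(1) by force
  qed
  have "inj_on ?g ?S"
  proof (rule inj_onI)
    fix a b assume ab: "a \<in> ?S" "b \<in> ?S" "?g a = ?g b"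
    have "M a (?g a) \<noteq> 0" using g[OF ab(1)] by (rule conjunct2)
    moreover have "M b (?g a) \<noteq> 0" unfolding ab(3) using g[OF ab(2)] by (rule conjunct2)
    ultimately show "a = b" by (rule M_disjoint)
  qed
  moreover have "?g ` ?S \<subseteq> ?D" by (rule image_subsetI) (rule conjunct1[OF g])
  then have "finite (?g ` ?S)" using fD by (rule finite_subset)
  ultimately show ?thesis by (rule finite_imageD[rotated])
qed

lemma perp_ex1: "\<exists>!Y. \<forall>G\<in>QSym. pairing Y G = pairing X (F \<star> G)"
proof
  let ?Y = "Poly_Mapping.Abs_poly_mapping (\<lambda>a. pairing X (F \<star> M a))"
  have lY: "Poly_Mapping.lookup ?Y a = pairing X (F \<star> M a)" for a
    using finite_pairing_support[of X F] by (simp add: lookup_Abs_poly_mapping)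
  show "\<forall>G\<in>QSym. pairing ?Y G = pairing X (F \<star> G)"
    by (auto simp: QSym_def ps_mult_sum_right pairing_sum_right pairing_M lY)
  show "Y = ?Y" if "\<forall>G\<in>QSym. pairing Y G = pairing X (F \<star> G)" for Y
  proof (rule poly_mapping_eqI)
    fix a
    have "Poly_Mapping.lookup Y a = pairing Y (M a)" by (simp add: pairing_M)
    also have "\<dots> = Poly_Mapping.lookup ?Y a" using that M_in_QSym lY by simp
    finally show "Poly_Mapping.lookup Y a = Poly_Mapping.lookup ?Y a" .
  qed
qed

lemma pairing_perp: "G \<in> QSym \<Longrightarrow> pairing (perp F X) G = pairing X (F \<star> G)"
  using theI'[OF perp_ex1[of X F]] unfolding perp_def by blast

definition mdeg :: "(nat \<Rightarrow>\<^sub>0 nat) \<Rightarrow> nat" where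
  "mdeg e = sum (Poly_Mapping.lookup e) (Poly_Mapping.keys e)"

lemma mdeg_add: "mdeg (a + b) = mdeg a + mdeg b"
proof -
  let ?S = "Poly_Mapping.keys a \<union> Poly_Mapping.keys b"
  have *: "mdeg c = sum (Poly_Mapping.lookup c) ?S" if "Poly_Mapping.keys c \<subseteq> ?S" for c
    unfolding mdeg_def by (rule sum.mono_neutral_left) (use that in \<open>auto simp: in_keys_iff\<close>)
  show ?thesis
    using Poly_Mapping.keys_add[of a b] by (simp add: * lookup_add sum.distrib)
qed

lemma mdeg_mono_at: "mdeg (mono_at is a) = sum_list a"
proof -
  have "mdeg (\<Sum>j\<in>S. Poly_Mapping.single (is ! j) (a ! j)) = (\<Sum>j\<in>S. a ! j)" if "finite S" for S
    using that
  proof induction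
    case empty
    then show ?case by (simp add: mdeg_def)
  next
    case (insert x S)
    have "mdeg (Poly_Mapping.single (is ! x) (a ! x)) = a ! x" by (simp add: mdeg_def)
    with insert show ?case by (simp add: mdeg_add)
  qed
  then show ?thesis by (simp add: mono_at_def sum_list_sum_nth atLeast0LessThan)
qed

lemma Fund_nz: "Fund a e \<noteq> 0 \<Longrightarrow> mdeg e = size_comp a"
proof -
  assume "Fund a e \<noteq> 0"
  then obtain b where "comp_le b a" "M b e \<noteq> 0"
    unfolding Fund_def by (metis (mono_tags, lifting) mem_Collect_eq sum.neutral)
  then show ?thesis by (metis M_nz comp_le_def mdeg_mono_at size_comp_def)
qed

lemma finite_perp_ones: "finite {i. perp (Fund (ones i)) X \<noteq> 0}"
proof (rule finite_subset)
  show "finite (\<Union>x\<in>Poly_Mapping.keys X. {..mdeg (packed x)})" by simp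
  show "{i. perp (Fund (ones i)) X \<noteq> 0} \<subseteq> (\<Union>x\<in>Poly_Mapping.keys X. {..mdeg (packed x)})"
  proof
    fix i assume "i \<in> {i. perp (Fund (ones i)) X \<noteq> 0}"
    then obtain a where "Poly_Mapping.lookup (perp (Fund (ones i)) X) a \<noteq> 0"
      by (auto simp: poly_mapping_eq_iff fun_eq_iff)
    then have "pairing X (Fund (ones i) \<star> M a) \<noteq> 0"
      by (simp add: pairing_M flip: pairing_perp[OF M_in_QSym])
    then obtain x where x: "x \<in> Poly_Mapping.keys X" "(Fund (ones i) \<star> M a) (packed x) \<noteq> 0"
      unfolding pairing_def by (metis (no_types, lifting) mult_zero_right sum.neutral)
    from ps_mult_nz[OF x(2)] obtain d b where db: "d + b = packed x" "Fund (ones i) d \<noteq> 0" by metis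
    have "mdeg d = i" using Fund_nz[OF db(2)]
      by (simp add: size_comp_def ones.rep_eq sum_list_replicate)
    then have "i \<le> mdeg (packed x)" using db(1) mdeg_add[of d b] by simp
    then show "i \<in> (\<Union>x\<in>Poly_Mapping.keys X. {..mdeg (packed x)})" using x(1) by blast
  qed
qed

end

theory Submission
  imports Defs
begin

text \<open>
  Since \<open>F\<^bsub>1^i\<^esub>\<close> is the elementary symmetric function \<open>e\<^sub>i\<close>, the map
  \<open>\<Delta> X = \<Sum>\<^sub>i t^i e\<^sub>i\<^sup>\<bottom> X\<close> is a ring homomorphism into \<open>NSym[[t]]\<close> with
  \<open>\<Delta> H\<^sub>n = H\<^sub>n + t H\<^bsub>n-1\<^esub>\<close>, that is, \<open>\<Delta> \<sigma>(u) = \<sigma>(u) (1 + t u)\<close>. Differentiating in \<open>u\<close> gives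
  \<open>\<Delta> \<psi>(u) = \<psi>(u) + t / (1 + t u)\<close>, whence
  \<open>B\<^sub>m(X) \<Psi>\<^sub>k = B\<^sub>m(X \<Psi>\<^sub>k) + B\<^bsub>m+k\<^esub>(X)\<close>. Moving \<open>\<Psi>\<^sub>k\<close> inwards through all operators
  produces the first sum of the theorem and leaves \<open>\<Psi>\<^sub>k\<close> itself in place of \<open>1\<close>. The same identity with
  \<open>m = 0\<close>, \<open>X = 1\<close> reads \<open>\<Psi>\<^sub>k = H\<^sub>k + B\<^sub>0(\<Psi>\<^sub>k)\<close>, and iterating it yields the second sum as soon
  as \<open>B\<^sub>0^k(\<Psi>\<^sub>k) = 0\<close>. For the latter, write \<open>\<psi> = \<lambda> \<sigma>'\<close> with \<open>\<lambda> = \<sigma>^(-1)\<close>;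
  then \<open>B\<^sub>0\<close> maps \<open>\<lambda>\<^sub>a H\<^sub>b\<close> to \<open>\<lambda>\<^bsub>a+1\<^esub> H\<^bsub>b-1\<^esub>\<close> (plus \<open>H\<^sub>b\<close> if \<open>a = 0\<close>), which after \<open>k\<close> steps
  flattens the coefficients of \<open>\<Psi>\<^sub>k\<close> to \<open>k \<Sum>\<^sub>a \<lambda>\<^sub>a H\<^bsub>k-a\<^esub> = 0\<close>.
\<close>

section \<open>The adjoint of multiplication by an elementary symmetric function\<close>

lemma parts_Composition_filter [simp]:
  "parts (Composition (filter ((<) 0) xs)) = filter ((<) 0) xs"
  by (simp add: Composition_inverse)

lemma length_le_sum_list: "0 \<notin> set xs \<Longrightarrow> length xs \<le> sum_list xs" for xs :: "nat list"
  by (induction xs) (auto simp: Suc_le_eq)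

lemma eq_replicate_1:
  "0 \<notin> set xs \<Longrightarrow> sum_list xs \<le> length xs \<Longrightarrow> xs = replicate (length xs) 1" for xs :: "nat list"
proof (induction xs)
  case (Cons x xs)
  with length_le_sum_list[of xs] show ?case by auto
qed simp

text \<open>A composition of i below \<open>ones i\<close> has all of 1, ..., i-1 as descents, hence
  at least i parts; i positive parts with sum i are all 1.\<close>

lemma Fund_ones: "Fund (ones i) = M (ones i)"
proof -
  have "b = ones i" if "comp_le b (ones i)" for b
  proof -
    let ?n = "length (parts b)"
    have size: "sum_list (parts b) = i"
      using that by (simp add: comp_le_def size_comp_def ones.rep_eq sum_list_replicate)
    have "{1..<i} = descents (ones i)"
      by (force simp: descents_def ones.rep_eq sum_list_replicate min_def)
    also have "\<dots> \<subseteq> (\<lambda>j. sum_list (take j (parts b))) ` {1..<?n}"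
      using that by (force simp: comp_le_def descents_def)
    finally have "card {1..<i} \<le> card {1..<?n}"
      by (rule surj_card_le[rotated]) simp
    \<comment> \<open>The cardinalities only compare \<open>i - 1\<close> with \<open>?n - 1\<close>
      in truncated subtraction, which would admit \<open>?n = 0\<close> with
      \<open>i = 1\<close>.\<close>
    moreover have "?n \<noteq> 0 \<or> i = 0"
      using size by auto
    ultimately have len: "i \<le> ?n"
      by (simp only: card_atLeastLessThan) linarith
    have "parts b = replicate i 1"
      using eq_replicate_1[of "parts b"] length_le_sum_list[of "parts b"] parts_pos[of b] len size
      by (metis order_antisym)
    then show ?thesis by (simp add: ones.rep_eq flip: parts_inject)
  qed
  then have "{b. comp_le b (ones i)} = {ones i}"
    by (auto simp: comp_le_def)
  then show ?thesis by (simp add: Fund_def fun_eq_iff)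
qed

text \<open>Zero entries are allowed, unlike in \<open>packed\<close>, because a divisor of a packed
  monomial may skip variables.\<close>

definition exponents :: "nat list \<Rightarrow> (nat \<Rightarrow>\<^sub>0 nat)" where
  "exponents xs = mono_at [0..<length xs] xs"

lemma packed_eq_exponents: "packed a = exponents (parts a)"
  by (simp add: packed_def exponents_def)

lemma lookup_exponents:
  "Poly_Mapping.lookup (exponents xs) v = (if v < length xs then xs ! v else 0)"
  unfolding exponents_def
  using lookup_mono_at(1)[of "[0..<length xs]" xs v] lookup_mono_at(2)[of "[0..<length xs]" xs v]
  by auto

text \<open>The nonzero positions of \<open>xs\<close> form the only increasing index list that can
  produce this monomial, so reading off a coefficient amounts to deleting zeros.\<close>

lemma M_exponents:
  "M a (exponents xs) = (if filter ((<) 0) xs = parts a then 1 else 0)"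
proof -
  define js where "js = filter (\<lambda>v. xs ! v \<noteq> 0) [0..<length xs]"
  define c where "c = Composition (filter ((<) 0) xs)"
  have c: "parts c = map ((!) xs) js"
    using filter_map[of "(<) 0" "(!) xs" "[0..<length xs]"]
    unfolding c_def parts_Composition_filter js_def map_nth by (simp add: o_def)
  have js: "sorted_wrt (<) js"
    unfolding js_def by (intro sorted_wrt_filter) simp
  then have dist: "distinct js" by (simp add: strict_sorted_iff)
  have len: "length js = length (parts c)" by (simp add: c)
  have mono: "mono_at js (parts c) = exponents xs"
  proof (rule poly_mapping_eqI)
    fix v
    show "Poly_Mapping.lookup (mono_at js (parts c)) v
        = Poly_Mapping.lookup (exponents xs) v"
    proof (cases "v \<in> set js")
      case True
      then obtain j where "j < length js" "v = js ! j" by (metis in_set_conv_nth)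
      with True lookup_mono_at(1)[OF dist len] len show ?thesis
        by (simp add: lookup_exponents c js_def)
    next
      case False
      then show ?thesis
        using lookup_mono_at(2)[OF dist len] by (auto simp: lookup_exponents js_def)
    qed
  qed
  have "(length ks = length (parts a) \<and> sorted_wrt (<) ks \<and> mono_at ks (parts a) = exponents xs)
      \<longleftrightarrow> ks = js \<and> a = c" for ks
    using mono_at_inject[of ks js a c] js len mono by metis
  then have "{ks. length ks = length (parts a) \<and> sorted_wrt (<) ks
      \<and> mono_at ks (parts a) = exponents xs} = (if a = c then {js} else {})"
    by simp
  moreover have "a = c \<longleftrightarrow> filter ((<) 0) xs = parts a"
    by (auto simp: c_def parts_inverse)
  ultimately show ?thesis by (simp add: M_def)
qed

definition lists_le :: "nat list \<Rightarrow> nat list set" where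
  "lists_le xs = {ys. list_all2 (\<le>) ys xs}"

lemma lists_le_Nil [simp]: "lists_le [] = {[]}"
  by (auto simp: lists_le_def)

lemma lists_le_Cons: "lists_le (x # xs) = (\<lambda>(y, ys). y # ys) ` ({..x} \<times> lists_le xs)"
  by (auto simp: lists_le_def list_all2_Cons2)

lemma sum_lists_le_Cons:
  "(\<Sum>ys\<in>lists_le (x # xs). f ys) = (\<Sum>y\<le>x. \<Sum>ys\<in>lists_le xs. f (y # ys))"
  unfolding lists_le_Cons sum.cartesian_product
  by (subst sum.reindex) (auto simp: inj_on_def intro!: sum.cong)

text \<open>A factor of \<open>exponents xs\<close> involves only the first \<open>length xs\<close>
  variables, so its list of exponents there determines it.\<close>

lemma ps_mult_exponents:
  "(F \<star> G) (exponents xs) =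
    (\<Sum>ys\<in>lists_le xs. F (exponents ys)
       * G (exponents (map2 (-) xs ys)))"
proof -
  let ?l = "Poly_Mapping.lookup :: (nat \<Rightarrow>\<^sub>0 nat) \<Rightarrow> _"
  have eq: "?l a v + ?l b v = ?l (exponents xs) v" if "a + b = exponents xs" for a b v
    using that by (metis lookup_add)
  have inv: "exponents (map (?l a) [0..<length xs]) = a" if "a + b = exponents xs" for a b
  proof (rule poly_mapping_eqI)
    show "?l (exponents (map (?l a) [0..<length xs])) v = ?l a v" for v
      using eq[OF that, of v] by (simp add: lookup_exponents split: if_splits)
  qed
  have inv': "exponents (map2 (-) xs (map (?l a) [0..<length xs])) = b" if "a + b = exponents xs" for a b
  proof (rule poly_mapping_eqI)
    show "?l (exponents (map2 (-) xs (map (?l a) [0..<length xs]))) v = ?l b v" for v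
      using eq[OF that, of v] by (auto simp: lookup_exponents split: if_splits)
  qed
  show ?thesis
    unfolding ps_mult_def
  proof (rule sum.reindex_bij_witness[where
        i = "\<lambda>ys. (exponents ys, exponents (map2 (-) xs ys))" and
        j = "\<lambda>(a, b). map (?l a) [0..<length xs]"], goal_cases)
    case (1 p)
    then obtain a b where p: "p = (a, b)" "a + b = exponents xs" by auto
    with inv inv' show ?case by simp
  next
    case (2 p)
    then obtain a b where p: "p = (a, b)" "a + b = exponents xs" by auto
    have "?l a v \<le> xs ! v" if "v < length xs" for v
      using eq[OF p(2), of v] that by (simp add: lookup_exponents)
    with p show ?case by (simp add: lists_le_def list_all2_conv_all_nth)
  next
    case (3 ys)
    then have "length ys = length xs" by (simp add: lists_le_def list_all2_lengthD)
    then show ?case by (auto intro: nth_equalityI simp: lookup_exponents)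
  next
    case (4 ys)
    then have "list_all2 (\<le>) ys xs" by (simp add: lists_le_def)
    then show ?case
      by (auto simp: list_all2_conv_all_nth lookup_add lookup_exponents intro!: poly_mapping_eqI)
  next
    case (5 p)
    then obtain a b where p: "p = (a, b)" "a + b = exponents xs" by auto
    with inv inv' show ?case by simp
  qed
qed

lemma lookup_perp: "Poly_Mapping.lookup (perp F X) a = pairing X (F \<star> M a)"
  by (simp add: pairing_perp[OF M_in_QSym] flip: pairing_M)

lemma perp_add: "perp F (X + Y) = perp F X + perp F Y"
  by (rule poly_mapping_eqI) (simp add: lookup_perp lookup_add pairing_add_left)

definition H_list :: "nat list \<Rightarrow> nsym" where
  "H_list zs = prod_list (map (\<lambda>n. H (int n)) zs)"

lemma H_list_eq: "H_list zs = H_comp (Composition (filter ((<) 0) zs))"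
proof -
  have "H_list zs = prod_list (map (\<lambda>n. H (int n)) (filter ((<) 0) zs))"
    by (induction zs) (auto simp: H_list_def H_def)
  then show ?thesis by (simp add: H_comp_eq_prod)
qed

definition E_perp :: "nat \<Rightarrow> nsym \<Rightarrow> nsym" where
  "E_perp i = perp (Fund (ones i))"

text \<open>Pairing with \<open>M a\<close> reads the coefficient of \<open>packed b\<close> in the
  product of e_i and \<open>M a\<close>. The factor e_i admits exactly the divisors with i entries 1
  and all others 0, so i parts of \<open>b\<close> drop by one.\<close>

lemma E_perp_H_comp:
  "E_perp i (H_comp b) =
    (\<Sum>ys\<in>lists_le (parts b). if filter ((<) 0) ys = replicate i 1
       then H_list (map2 (-) (parts b) ys) else 0)"
proof (rule poly_mapping_eqI)
  fix a
  have *: "Poly_Mapping.lookup (H_list zs) a = (if filter ((<) 0) zs = parts a then 1 else 0)" for zs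
    by (auto simp: H_list_eq H_comp_def lookup_single when_def parts_inverse)
  show "Poly_Mapping.lookup (E_perp i (H_comp b)) a =
    Poly_Mapping.lookup (\<Sum>ys\<in>lists_le (parts b). if filter ((<) 0) ys = replicate i 1
       then H_list (map2 (-) (parts b) ys) else 0) a"
    unfolding E_perp_def lookup_perp lookup_sum Fund_ones
    by (simp add: pairing_def H_comp_def packed_eq_exponents ps_mult_exponents M_exponents ones.rep_eq
        if_distrib[of "\<lambda>x. Poly_Mapping.lookup x a"] * cong: if_cong)
      (auto intro!: sum.cong)
qed

section \<open>Multiplicativity of the generating series of the adjoints\<close>

definition Delta :: "nsym \<Rightarrow> nsym fps" where
  "Delta X = Abs_fps (\<lambda>i. E_perp i X)"

lemma E_perp_eq: "E_perp i X = fps_nth (Delta X) i"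
  by (simp add: Delta_def)

text \<open>Each part is independently kept or lowered by one, and t records the lowered
  ones.\<close>

lemma Delta_H_comp:
  "Delta (H_comp b) =
    prod_list (map (\<lambda>n. fps_const (H (int n)) + fps_X * fps_const (H (int n - 1))) (parts b))"
proof -
  define d where "d i xs = (\<Sum>ys\<in>lists_le xs. if filter ((<) 0) ys = replicate i 1
       then H_list (map2 (-) xs ys) else 0)" for i xs
  have d_Nil: "d i [] = (if i = 0 then 1 else 0)" for i
    by (auto simp: d_def H_list_def)
  have d_Cons: "d i (x # xs) = H (int x) * d i xs
      + (if i = 0 then 0 else H (int x - 1) * d (i - 1) xs)" for i x xs
  proof -
    define g where "g y = H (int x - int y) * (\<Sum>ys\<in>lists_le xs.
      if filter ((<) 0) (y # ys) = replicate i 1 then H_list (map2 (-) xs ys) else 0)" for y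
    have "d i (x # xs) = (\<Sum>y\<le>x. g y)"
      unfolding d_def sum_lists_le_Cons g_def sum_distrib_left
      by (intro sum.cong refl) (auto simp: H_list_def of_nat_diff)
    also have "\<dots> = (\<Sum>y\<in>{0, 1}. g y)"
    proof (rule sum.mono_neutral_cong)
      show "g y = 0" if "y \<in> {..x} - {0, 1}" for y
      proof -
        have "y # ys \<noteq> replicate i (1 :: nat)" for ys using that by (cases i) auto
        with that show ?thesis by (auto simp: g_def)
      qed
      \<comment> \<open>For \<open>x = 0\<close> the index 1 lies outside the range, but its term
        contains \<open>H (-1) = 0\<close>.\<close>
      show "g y = 0" if "y \<in> {0, 1} - {..x}" for y
        using that by (auto simp: g_def H_def)
    qed auto
    also have "\<dots> = g 0 + g 1" by simp
    also have "g 0 = H (int x) * d i xs"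
      by (simp add: g_def d_def cong: if_cong)
    also have "g 1 = (if i = 0 then 0 else H (int x - 1) * d (i - 1) xs)"
      by (cases i) (simp_all add: g_def d_def cong: if_cong)
    finally show ?thesis .
  qed
  have "Abs_fps (\<lambda>i. d i xs) =
      prod_list (map (\<lambda>n. fps_const (H (int n)) + fps_X * fps_const (H (int n - 1))) xs)" for xs
  proof (induction xs)
    case Nil
    show ?case by (rule fps_ext) (simp add: d_Nil)
  next
    case (Cons x xs)
    show ?case
      by (rule fps_ext) (simp add: d_Cons distrib_right mult.assoc flip: Cons)
  qed
  then show ?thesis by (simp add: Delta_def E_perp_H_comp d_def)
qed

lemma Delta_add: "Delta (X + Y) = Delta X + Delta Y"
  by (rule fps_ext) (simp add: Delta_def E_perp_def perp_add)

lemma Delta_1 [simp]: "Delta 1 = 1"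
  using Delta_H_comp[of 0] by (simp add: H_comp_def zero_composition.rep_eq)

lemma nsym_induct [case_names single add]:
  fixes X :: nsym
  assumes "\<And>a c. P (Poly_Mapping.single a c)" "\<And>X Y. P X \<Longrightarrow> P Y \<Longrightarrow> P (X + Y)"
  shows "P X"
proof (induction X rule: update_induct)
  case const
  show ?case using assms(1)[of 0 0] by simp
next
  case (update X a c)
  then have "Poly_Mapping.update a c X = X + Poly_Mapping.single a c"
    by (intro poly_mapping_eqI)
      (auto simp: lookup_update lookup_add lookup_single when_def in_keys_iff)
  with update assms show ?case by simp
qed

text \<open>The elements \<open>single 0 c\<close> are the rational scalars inside NSym; their
  centrality lets coefficients be pulled out of noncommutative products.\<close>

lemma single_0_commute: "Poly_Mapping.single 0 c * X = X * Poly_Mapping.single 0 (c :: rat)"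
  for X :: nsym
  by (induction X rule: nsym_induct) (simp_all add: mult_single distrib_left distrib_right mult.commute)

lemma lookup_single_0_times:
  "Poly_Mapping.lookup (Poly_Mapping.single 0 c * X) a = c * Poly_Mapping.lookup X a"
  for X :: nsym
  by (induction X rule: nsym_induct)
    (auto simp: mult_single distrib_left lookup_add lookup_single when_def)

lemma Delta_single:
  "Delta (Poly_Mapping.single b c) = fps_const (Poly_Mapping.single 0 c) * Delta (H_comp b)"
proof -
  have "pairing (Poly_Mapping.single b c) G = c * pairing (H_comp b) G" for G
    by (simp add: pairing_def H_comp_def)
  then show ?thesis
    by (intro fps_ext poly_mapping_eqI) (simp add: Delta_def E_perp_def lookup_perp lookup_single_0_times)
qed

text \<open>Both sides are biadditive, and on basis elements \<open>Delta_H_comp\<close> turns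
  concatenation into a product.\<close>

lemma Delta_mult: "Delta (X * Y) = Delta X * Delta Y"
proof (induction X rule: nsym_induct)
  case (single a c)
  show ?case
  proof (induction Y rule: nsym_induct)
    case (single b d)
    have comm: "fps_const (Poly_Mapping.single 0 d) * f = f * fps_const (Poly_Mapping.single 0 d)"
      for f :: "nsym fps"
      by (rule fps_ext) (simp add: single_0_commute)
    have "Delta (H_comp (a + b)) = Delta (H_comp a) * Delta (H_comp b)"
      by (simp add: Delta_H_comp plus_composition.rep_eq)
    then have "Delta (Poly_Mapping.single a c * Poly_Mapping.single b d)
        = fps_const (Poly_Mapping.single 0 c)
          * (fps_const (Poly_Mapping.single 0 d) * Delta (H_comp a)) * Delta (H_comp b)"
      by (simp add: mult_single Delta_single mult.assoc flip: fps_const_mult)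
        (simp add: mult_single flip: mult.assoc)
    also have "\<dots> = Delta (Poly_Mapping.single a c) * Delta (Poly_Mapping.single b d)"
      unfolding comm by (simp add: Delta_single mult.assoc)
    finally show ?case .
  next
    case (add X Y)
    then show ?case by (simp add: distrib_left Delta_add)
  qed
next
  case (add X Y)
  then show ?case by (simp add: distrib_right Delta_add)
qed

lemma Delta_H: "Delta (H (int n)) = fps_const (H (int n)) + fps_X * fps_const (H (int n - 1))"
proof (cases "n = 0")
  case False
  then have "H (int n) = H_comp (Composition [n])" by (simp add: H_def)
  with False show ?thesis by (simp add: Delta_H_comp Composition_inverse)
qed (simp add: H_def)

section \<open>Ring homomorphisms acting on coefficients of power series\<close>

locale ring_1_hom =
  fixes g :: "'a::ring_1 \<Rightarrow> 'b::ring_1"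
  assumes add: "g (x + y) = g x + g y" and mult: "g (x * y) = g x * g y" and one: "g 1 = 1"
begin

text \<open>Applied to series in u: \<open>Delta\<close> and the embedding of constants both lead
  into series in u over NSym[[t]], where they can be compared.\<close>

definition map_fps :: "'a fps \<Rightarrow> 'b fps" where
  "map_fps f = Abs_fps (\<lambda>n. g (fps_nth f n))"

lemma map_fps_nth [simp]: "fps_nth (map_fps f) n = g (fps_nth f n)"
  by (simp add: map_fps_def)

lemma zero: "g 0 = 0"
  using add[of 0 0] by simp

lemma sum: "g (sum f A) = (\<Sum>x\<in>A. g (f x))"
  using sum_comp_morphism[of g f A] by (simp add: zero add o_def)

lemma of_nat: "g (of_nat n) = of_nat n"
  by (induction n) (simp_all add: zero add one)

lemma map_fps_mult: "map_fps (f * h) = map_fps f * map_fps h"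
  by (rule fps_ext) (simp add: fps_mult_nth sum mult)

lemma map_fps_1: "map_fps 1 = 1"
  by (rule fps_ext) (simp add: zero one)

lemma map_fps_deriv: "map_fps (fps_deriv f) = fps_deriv (map_fps f)"
  by (rule fps_ext) (simp add: mult of_nat flip: of_nat_Suc)

end

interpretation Delta: ring_1_hom Delta
  by standard (simp_all add: Delta_add Delta_mult)

interpretation const: ring_1_hom "fps_const :: nsym \<Rightarrow> nsym fps"
  by standard simp_all

section \<open>The coproduct of the power sums\<close>

text \<open>The coefficients are the noncommutative elementary functions with sign
  \<open>(-1)^n\<close>.\<close>

definition lam :: "nsym fps" where
  "lam = fps_left_inverse sigma 1"

lemma sigma_nth: "fps_nth sigma n = H (int n)"
  by (simp add: sigma_def)

lemma H_0 [simp]: "H 0 = 1" and H_neg: "n < 0 \<Longrightarrow> H n = 0"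
  by (simp_all add: H_def)

lemma lam_sigma: "lam * sigma = 1"
  unfolding lam_def by (rule fps_left_inverse) (simp add: sigma_nth)

lemma sigma_lam: "sigma * lam = 1"
proof -
  have R: "sigma * fps_right_inverse sigma 1 = 1"
    by (rule fps_right_inverse) (simp add: sigma_nth)
  have "lam * (sigma * fps_right_inverse sigma 1) = fps_right_inverse sigma 1"
    by (simp only: mult.assoc[symmetric] lam_sigma mult_1_left)
  with R show ?thesis by simp
qed

lemma lam_0 [simp]: "fps_nth lam 0 = 1"
  by (simp add: lam_def)

text \<open>The inner variable \<open>fps_X\<close> below is \<open>t\<close>, the outer one is \<open>u\<close>.\<close>

definition one_plus_TX :: "nsym fps fps" where
  "one_plus_TX = 1 + fps_const fps_X * fps_X"

definition inv_one_plus_TX :: "nsym fps fps" where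
  "inv_one_plus_TX = Abs_fps (\<lambda>n. (- fps_X) ^ n)"

lemma one_plus_TX_commute: "one_plus_TX * f = f * one_plus_TX"
proof -
  have "fps_const fps_X * f = f * fps_const fps_X"
    by (rule fps_ext) (simp add: fps_mult_fps_X_commute)
  then have "fps_const fps_X * f * fps_X = f * (fps_const fps_X * fps_X)"
    by (simp only: mult.assoc)
  then have "fps_const fps_X * fps_X * f = f * (fps_const fps_X * fps_X)"
    by (simp only: mult.assoc fps_mult_fps_X_commute[of f])
  then show ?thesis by (simp add: one_plus_TX_def distrib_left distrib_right)
qed

lemma one_plus_TX_inverse: "one_plus_TX * inv_one_plus_TX = 1"
proof (rule fps_ext)
  show "fps_nth (one_plus_TX * inv_one_plus_TX) n = fps_nth 1 n" for n
    by (cases n) (simp_all add: one_plus_TX_def inv_one_plus_TX_def distrib_right mult.assoc)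
qed

lemma Delta_sigma: "Delta.map_fps sigma = const.map_fps sigma * one_plus_TX"
proof (rule fps_ext)
  fix n
  have "const.map_fps sigma * one_plus_TX = one_plus_TX * const.map_fps sigma"
    by (simp only: one_plus_TX_commute)
  also have "\<dots> = const.map_fps sigma + fps_const fps_X * (fps_X * const.map_fps sigma)"
    by (simp add: one_plus_TX_def distrib_right mult.assoc)
  finally show "fps_nth (Delta.map_fps sigma) n = fps_nth (const.map_fps sigma * one_plus_TX) n"
    using Delta_H[of n] by (cases n) (simp_all add: sigma_nth H_neg)
qed

text \<open>The left side is a left inverse of \<open>Delta.map_fps sigma\<close> and the right side
  a right inverse, so they agree.\<close>

lemma Delta_lam: "Delta.map_fps lam = inv_one_plus_TX * const.map_fps lam"
proof -
  have L: "Delta.map_fps lam * Delta.map_fps sigma = 1"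
    by (simp add: lam_sigma Delta.map_fps_1 flip: Delta.map_fps_mult)
  have "Delta.map_fps sigma * (inv_one_plus_TX * const.map_fps lam)
      = const.map_fps sigma * (one_plus_TX * inv_one_plus_TX) * const.map_fps lam"
    by (simp add: Delta_sigma mult.assoc)
  also have "\<dots> = 1"
    by (simp add: one_plus_TX_inverse sigma_lam const.map_fps_1 flip: const.map_fps_mult)
  finally have "Delta.map_fps lam
      = Delta.map_fps lam * (Delta.map_fps sigma * (inv_one_plus_TX * const.map_fps lam))"
    by simp
  also have "\<dots> = inv_one_plus_TX * const.map_fps lam"
    by (simp only: mult.assoc[symmetric] L mult_1_left)
  finally show ?thesis .
qed

lemma Delta_psi: "Delta.map_fps psi = const.map_fps psi + inv_one_plus_TX * fps_const fps_X"
proof -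
  have L: "Delta.map_fps lam * Delta.map_fps sigma = 1"
    by (simp add: lam_sigma Delta.map_fps_1 flip: Delta.map_fps_mult)
  have U: "one_plus_TX * (inv_one_plus_TX * fps_const fps_X) = fps_const fps_X"
    by (simp add: one_plus_TX_inverse flip: mult.assoc)
  have "Delta.map_fps sigma * Delta.map_fps psi = fps_deriv (const.map_fps sigma * one_plus_TX)"
    by (simp add: psi_deriv flip: Delta.map_fps_mult Delta.map_fps_deriv Delta_sigma)
  also have "\<dots> = const.map_fps sigma * fps_const fps_X
      + const.map_fps sigma * (const.map_fps psi * one_plus_TX)"
    by (simp add: one_plus_TX_def psi_deriv const.map_fps_mult mult.assoc flip: const.map_fps_deriv)
  \<comment> \<open>The central factor 1 + tu is extracted from both terms so that
    \<open>Delta.map_fps sigma\<close> reappears on the left and can be cancelled.\<close>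
  also have "\<dots> = const.map_fps sigma * one_plus_TX
      * (const.map_fps psi + inv_one_plus_TX * fps_const fps_X)"
    by (simp add: distrib_left mult.assoc U one_plus_TX_commute[of "const.map_fps psi"] add.commute)
  finally have "Delta.map_fps lam * (Delta.map_fps sigma * Delta.map_fps psi) =
      Delta.map_fps lam * (Delta.map_fps sigma
        * (const.map_fps psi + inv_one_plus_TX * fps_const fps_X))"
    by (simp only: Delta_sigma)
  then show ?thesis by (simp only: mult.assoc[symmetric] L mult_1_left)
qed

lemma E_perp_add: "E_perp i (X + Y) = E_perp i X + E_perp i Y"
  by (simp add: E_perp_eq Delta_add)

lemma E_perp_mult: "E_perp i (X * Y) = (\<Sum>j\<le>i. E_perp j X * E_perp (i - j) Y)"
  by (simp add: E_perp_eq Delta_mult fps_mult_nth atLeast0AtMost)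

lemma E_perp_H: "E_perp i (H (int n)) = (if i = 0 then H (int n) else if i = 1 then H (int n - 1) else 0)"
  by (simp add: E_perp_eq Delta_H)

lemma minus_fps_X_power: "(- fps_X :: 'a::ring_1 fps) ^ n = fps_const ((-1) ^ n) * fps_X ^ n"
  by (rule fps_ext) (simp add: power_minus[of fps_X] minus_one_power_iff)

lemma E_perp_lam: "E_perp i (fps_nth lam n) = (if i \<le> n then (-1) ^ i * fps_nth lam (n - i) else 0)"
proof -
  have "Delta (fps_nth lam n) = fps_nth (Delta.map_fps lam) n" by simp
  also have "\<dots> = (\<Sum>j\<le>n. fps_const ((-1) ^ j) * (fps_X ^ j * fps_const (fps_nth lam (n - j))))"
    by (simp only: Delta_lam fps_mult_nth const.map_fps_nth)
      (simp add: inv_one_plus_TX_def minus_fps_X_power mult.assoc atLeast0AtMost)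
  finally have "E_perp i (fps_nth lam n) = (\<Sum>j\<le>n. if j = i then (-1) ^ j * fps_nth lam (n - j) else 0)"
    by (simp only: E_perp_eq fps_sum_nth) (rule sum.cong, auto)
  then show ?thesis by simp
qed

text \<open>The coefficient of u^(k-1) in t / (1 + tu) is -(-t)^k.\<close>

lemma E_perp_Psi:
  assumes "k > 0"
  shows "E_perp i (Psi k) = (if i = 0 then Psi k else if i = k then - ((-1) ^ k) else 0)"
proof -
  have "Delta (Psi k) = fps_nth (Delta.map_fps psi) (k - 1)" by (simp add: Psi_def)
  also have "\<dots> = fps_const (Psi k) + fps_const ((-1) ^ (k - 1)) * fps_X ^ k"
    using assms by (cases k)
     (simp_all add: Delta_psi Psi_def inv_one_plus_TX_def minus_fps_X_power mult.assoc power_commutes)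
  finally show ?thesis
    using assms by (cases k) (auto simp: E_perp_eq)
qed

section \<open>Creation operators and power sums\<close>

lemma BB_eq_sum:
  assumes "\<And>i. i \<ge> N \<Longrightarrow> E_perp i X = 0"
  shows "BB m X = (\<Sum>i<N. (-1) ^ i * H (m + int i) * E_perp i X)"
  unfolding BB_def E_perp_def[symmetric]
proof (rule Sum_any.expand_superset)
  show "{i. (-1) ^ i * H (m + int i) * E_perp i X \<noteq> 0} \<subseteq> {..<N}"
    using assms by (force simp: not_le[symmetric])
qed simp

lemma E_perp_eventually_0: obtains N where "\<And>i. i \<ge> N \<Longrightarrow> E_perp i X = 0"
proof -
  have "finite {i. E_perp i X \<noteq> 0}" using finite_perp_ones[of X] by (simp add: E_perp_def)
  then obtain N where "\<forall>i\<in>{i. E_perp i X \<noteq> 0}. i < N"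
    unfolding finite_nat_set_iff_bounded by blast
  then show ?thesis using that[of N] by (force simp: not_le[symmetric])
qed

lemma BB_add: "BB m (X + Y) = BB m X + BB m Y"
proof -
  obtain N1 N2 where N: "\<And>i. i \<ge> N1 \<Longrightarrow> E_perp i X = 0" "\<And>i. i \<ge> N2 \<Longrightarrow> E_perp i Y = 0"
    by (metis E_perp_eventually_0)
  define N where "N = max N1 N2"
  have "E_perp i X = 0" "E_perp i Y = 0" if "i \<ge> N" for i
    using N that by (simp_all add: N_def)
  then show ?thesis
    by (simp add: BB_eq_sum[of N] E_perp_add distrib_left sum.distrib)
qed

lemma BB_0 [simp]: "BB m 0 = 0"
  using BB_add[of m 0 0] by simp

lemma BB_sum: "BB m (sum f A) = (\<Sum>x\<in>A. BB m (f x))"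
  using sum_comp_morphism[of "BB m" f A] by (simp add: BB_add o_def)

lemma BB_of_nat_mult: "BB m (of_nat n * X) = of_nat n * BB m X"
  by (induction n) (simp_all add: distrib_right BB_add)

lemma E_perp_1: "E_perp i 1 = (if i = 0 then 1 else 0)"
  by (simp add: E_perp_eq)

lemma BB_1: "BB m 1 = H m"
  by (subst BB_eq_sum[of 1]) (simp_all add: E_perp_1)

text \<open>By \<open>E_perp_Psi\<close>, only two terms of the Leibniz rule survive. One yields
  \<open>BB m X * Psi k\<close>; in the other, shifting i by k cancels the sign
  \<open>(-1)^k\<close> and raises the index of \<open>H\<close> by k.\<close>

lemma BB_mult_Psi:
  assumes "k > 0"
  shows "BB m X * Psi k = BB m (X * Psi k) + BB (m + int k) X"
proof -
  obtain N where N: "\<And>i. i \<ge> N \<Longrightarrow> E_perp i X = 0" by (metis E_perp_eventually_0)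
  have E: "E_perp i (X * Psi k) = E_perp i X * Psi k
      - (if i \<ge> k then (-1) ^ k * E_perp (i - k) X else 0)" for i
  proof -
    have "E_perp i (X * Psi k) = (\<Sum>j\<le>i. E_perp j X * (if i - j = 0 then Psi k else 0))
        + (\<Sum>j\<le>i. E_perp j X * (if i - j = k then - ((-1) ^ k) else 0))"
      using assms unfolding E_perp_mult E_perp_Psi[OF assms] sum.distrib[symmetric]
      by (intro sum.cong) auto
    also have "(\<Sum>j\<le>i. E_perp j X * (if i - j = 0 then Psi k else 0))
        = (\<Sum>j\<le>i. if j = i then E_perp j X * Psi k else 0)"
      by (intro sum.cong) auto
    also have "(\<Sum>j\<le>i. E_perp j X * (if i - j = k then - ((-1) ^ k) else 0))
        = (\<Sum>j\<le>i. if j = i - k then (if i \<ge> k then - ((-1) ^ k * E_perp j X) else 0) else 0)"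
      using assms by (intro sum.cong) (auto simp: minus_one_power_iff)
    finally show ?thesis by auto
  qed
  \<comment> \<open>The shift by k in the correction term moves the cutoff from \<open>N\<close> to
    \<open>N + k\<close>.\<close>
  have "BB m (X * Psi k) = (\<Sum>i<N + k. (-1) ^ i * H (m + int i) * E_perp i (X * Psi k))"
    using N by (intro BB_eq_sum) (simp add: E)
  also have "\<dots> = (\<Sum>i<N + k. (-1) ^ i * H (m + int i) * E_perp i X) * Psi k
      - (\<Sum>i<N + k. if i \<ge> k then (-1) ^ i * H (m + int i) * ((-1) ^ k * E_perp (i - k) X) else 0)"
    unfolding sum_distrib_right sum_subtractf[symmetric] E
    by (intro sum.cong) (auto simp: algebra_simps)
  also have "(\<Sum>i<N + k. (-1) ^ i * H (m + int i) * E_perp i X) = BB m X"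
    using N by (intro BB_eq_sum[symmetric]) simp
  also have "(\<Sum>i<N + k. if i \<ge> k then (-1) ^ i * H (m + int i) * ((-1) ^ k * E_perp (i - k) X) else 0)
      = (\<Sum>i = 0 + k..<N + k. (-1) ^ i * H (m + int i) * ((-1) ^ k * E_perp (i - k) X))"
    by (rule sum.mono_neutral_cong_right) auto
  also have "\<dots> = (\<Sum>i<N. (-1) ^ i * H (m + int k + int i) * E_perp i X)"
    unfolding sum.shift_bounds_nat_ivl lessThan_atLeast0
    by (intro sum.cong refl) (simp add: minus_one_power_iff add_ac)
  also have "\<dots> = BB (m + int k) X"
    by (rule BB_eq_sum[symmetric]) (rule N)
  finally show ?thesis by simp
qed

section \<open>Iterating the operator B_0 on a power sum\<close>

lemma sum_H_lam: "(\<Sum>i\<le>n. H (int i) * fps_nth lam (n - i)) = (if n = 0 then 1 else 0)"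
proof -
  have "(\<Sum>i\<le>n. H (int i) * fps_nth lam (n - i)) = fps_nth (sigma * lam) n"
    by (simp add: fps_mult_nth sigma_nth atLeast0AtMost)
  then show ?thesis by (simp add: sigma_lam)
qed

text \<open>Both resulting sums are convolutions of \<open>sigma\<close> with \<open>lam\<close>.
  The second misses its term at i = 0, and since the full sum vanishes, exactly that term is left
  over.\<close>

lemma BB_0_lam_mult_H:
  "BB 0 (fps_nth lam a * H (int b)) =
    (if a = 0 then H (int b) else 0) + fps_nth lam (Suc a) * H (int b - 1)"
proof -
  have E: "E_perp i (fps_nth lam a * H (int b)) = (-1) ^ i *
      ((if i \<le> a then fps_nth lam (a - i) * H (int b) else 0)
       - (if 0 < i \<and> i \<le> Suc a then fps_nth lam (Suc a - i) * H (int b - 1) else 0))" for i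
  proof (cases i)
    case 0
    then show ?thesis by (simp add: E_perp_mult E_perp_H E_perp_lam)
  next
    case (Suc l)
    \<comment> \<open>At most one unit can be removed from the single part of
      \<open>H (int b)\<close>, so only two Leibniz terms remain.\<close>
    have "E_perp i (fps_nth lam a * H (int b))
        = (\<Sum>j\<in>{l, i}. E_perp j (fps_nth lam a) * E_perp (i - j) (H (int b)))"
      unfolding E_perp_mult using Suc by (intro sum.mono_neutral_right) (auto simp: E_perp_H)
    with Suc show ?thesis by (auto simp: E_perp_H E_perp_lam minus_one_power_iff)
  qed
  have "BB 0 (fps_nth lam a * H (int b))
      = (\<Sum>i\<le>Suc a. (-1) ^ i * H (int i) * E_perp i (fps_nth lam a * H (int b)))"
    by (subst BB_eq_sum[of "Suc (Suc a)"]) (simp_all add: E lessThan_Suc_atMost)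
  also have "\<dots> = (\<Sum>i\<le>Suc a. H (int i) * ((if i \<le> a then fps_nth lam (a - i) * H (int b) else 0)
       - (if 0 < i \<and> i \<le> Suc a then fps_nth lam (Suc a - i) * H (int b - 1) else 0)))"
    unfolding E by (intro sum.cong refl) (simp add: minus_one_power_iff right_diff_distrib)
  also have "\<dots> = (\<Sum>i\<le>a. H (int i) * fps_nth lam (a - i)) * H (int b)
      - ((\<Sum>i\<le>Suc a. H (int i) * fps_nth lam (Suc a - i)) - fps_nth lam (Suc a)) * H (int b - 1)"
    unfolding right_diff_distrib sum_subtractf
  proof (rule arg_cong2[where f = "(-)"])
    show "(\<Sum>i\<le>Suc a. H (int i) * (if i \<le> a then fps_nth lam (a - i) * H (int b) else 0))
        = (\<Sum>i\<le>a. H (int i) * fps_nth lam (a - i)) * H (int b)"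
      by (simp add: sum_distrib_right mult.assoc)
    show "(\<Sum>i\<le>Suc a. H (int i) * (if 0 < i \<and> i \<le> Suc a
          then fps_nth lam (Suc a - i) * H (int b - 1) else 0))
        = ((\<Sum>i\<le>Suc a. H (int i) * fps_nth lam (Suc a - i)) - fps_nth lam (Suc a)) * H (int b - 1)"
      unfolding sum.atMost_Suc_shift by (simp add: sum_distrib_right mult.assoc)
  qed
  finally show ?thesis unfolding sum_H_lam by simp
qed

text \<open>The subtraction \<open>a - j\<close> is truncated: the coefficient is \<open>k\<close> for all \<open>a \<le> j\<close>.\<close>

lemma BB_0_iterate_Psi:
  assumes "k > 0"
  shows "(BB 0 ^^ j) (Psi k) = (\<Sum>a\<le>k. of_nat (k - (a - j)) * (fps_nth lam a * H (int k - int a)))"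
proof (induction j)
  case 0
  have "psi = lam * fps_deriv sigma"
    by (simp add: psi_deriv lam_sigma flip: mult.assoc)
  then have "Psi k = fps_nth (lam * fps_deriv sigma) (k - 1)"
    by (simp only: Psi_def)
  also have "\<dots> = (\<Sum>a\<le>k - 1. fps_nth lam a * (of_nat (Suc (k - 1 - a)) * H (int (Suc (k - 1 - a)))))"
    by (simp add: fps_mult_nth sigma_nth atLeast0AtMost del: of_nat_Suc)
  also have "\<dots> = (\<Sum>a\<le>k - 1. of_nat (k - a) * (fps_nth lam a * H (int k - int a)))"
  proof (intro sum.cong refl)
    fix a assume "a \<in> {..k - 1}"
    then have "Suc (k - 1 - a) = k - a" "int k - int a = int (k - a)"
      using assms by auto
    then show "fps_nth lam a * (of_nat (Suc (k - 1 - a)) * H (int (Suc (k - 1 - a))))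
        = of_nat (k - a) * (fps_nth lam a * H (int k - int a))"
      by (simp only: mult.assoc[symmetric] mult_of_nat_commute[of _ "fps_nth lam a"])
  qed
  also have "\<dots> = (\<Sum>a\<le>k. of_nat (k - a) * (fps_nth lam a * H (int k - int a)))"
  proof (rule sum.mono_neutral_left)
    show "\<forall>a\<in>{..k} - {..k - 1}. of_nat (k - a) * (fps_nth lam a * H (int k - int a)) = 0"
    proof
      fix a assume "a \<in> {..k} - {..k - 1}"
      then have "k - a = 0" unfolding Diff_iff atMost_iff by linarith
      then show "of_nat (k - a) * (fps_nth lam a * H (int k - int a)) = 0"
        by (simp only: of_nat_0 mult_zero_left)
    qed
  qed auto
  finally show ?case by simp
next
  case (Suc j)
  have B: "BB 0 (fps_nth lam a * H (int k - int a)) =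
      (if a = 0 then H (int k) else 0) + fps_nth lam (Suc a) * H (int k - int (Suc a))" if "a \<le> k" for a
  proof -
    have *: "int (k - a) = int k - int a" "int k - int a - 1 = int k - int (Suc a)"
      using that by auto
    show ?thesis using BB_0_lam_mult_H[of a "k - a"] unfolding * by (cases "a = 0") simp_all
  qed
  have "(BB 0 ^^ Suc j) (Psi k) =
      (\<Sum>a\<le>k. of_nat (k - (a - j)) * BB 0 (fps_nth lam a * H (int k - int a)))"
    by (simp only: funpow.simps comp_apply Suc BB_sum BB_of_nat_mult)
  also have "\<dots> = (\<Sum>a\<le>k. of_nat (k - (a - j))
      * ((if a = 0 then H (int k) else 0) + fps_nth lam (Suc a) * H (int k - int (Suc a))))"
    by (intro sum.cong refl) (simp only: atMost_iff B)
  \<comment> \<open>After reindexing by \<open>Suc a\<close>, the stray \<open>H (int k)\<close>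
    becomes the term at 0, and the excess term at \<open>Suc k\<close> dies because
    \<open>H (-1) = 0\<close>.\<close>
  also have "\<dots> = (\<Sum>a\<le>k. if a = 0 then of_nat k * H (int k) else 0)
      + (\<Sum>a\<le>k. of_nat (k - (Suc a - Suc j)) * (fps_nth lam (Suc a) * H (int k - int (Suc a))))"
    unfolding sum.distrib[symmetric] by (intro sum.cong refl) (auto simp: distrib_left)
  also have "\<dots> = (\<Sum>a\<le>Suc k. of_nat (k - (a - Suc j)) * (fps_nth lam a * H (int k - int a)))"
    unfolding sum.atMost_Suc_shift by simp
  also have "\<dots> = (\<Sum>a\<le>k. of_nat (k - (a - Suc j)) * (fps_nth lam a * H (int k - int a)))"
    by (simp add: H_neg)
  finally show ?case .
qed

text \<open>For j = k all the coefficients equal k, leaving k times the k-th coefficient of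
  \<open>lam * sigma = 1\<close>.\<close>

lemma BB_0_power_Psi:
  assumes "k > 0"
  shows "(BB 0 ^^ k) (Psi k) = 0"
proof -
  have "(BB 0 ^^ k) (Psi k) = of_nat k * (\<Sum>a\<le>k. fps_nth lam a * H (int (k - a)))"
    unfolding BB_0_iterate_Psi[OF assms] sum_distrib_left
    by (intro sum.cong) (simp_all add: of_nat_diff)
  also have "(\<Sum>a\<le>k. fps_nth lam a * H (int (k - a))) = fps_nth (lam * sigma) k"
    by (simp add: fps_mult_nth sigma_nth atLeast0AtMost)
  finally show ?thesis using assms by (simp add: lam_sigma)
qed

section \<open>Products of immaculate functions with a power sum\<close>

lemma immaculate_Nil: "immaculate [] = 1" and immaculate_Cons: "immaculate (m # g) = BB m (immaculate g)"
  by (simp_all add: immaculate_def)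

lemma immaculate_replicate_0: "immaculate (replicate j 0 @ g) = (BB 0 ^^ j) (immaculate g)"
  by (induction j) (simp_all add: immaculate_Cons)

lemma Psi_eq_sum_immaculate:
  assumes "k > 0"
  shows "Psi k = (\<Sum>j<k. immaculate (replicate j 0 @ [int k]))"
proof -
  have step: "Psi k = H (int k) + BB 0 (Psi k)"
    using BB_mult_Psi[OF assms, of 0 1] by (simp add: BB_1 add.commute)
  \<comment> \<open>Unrolling \<open>step\<close> n times keeps an explicit remainder, which
    vanishes at n = k.\<close>
  have "Psi k = (\<Sum>j<n. (BB 0 ^^ j) (H (int k))) + (BB 0 ^^ n) (Psi k)" for n
  proof (induction n)
    case (Suc n)
    have "(BB 0 ^^ n) (X + Y) = (BB 0 ^^ n) X + (BB 0 ^^ n) Y" for X Y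
      by (induction n) (simp_all add: BB_add)
    then have "(BB 0 ^^ n) (Psi k) = (BB 0 ^^ n) (H (int k)) + (BB 0 ^^ Suc n) (Psi k)"
      using step by (metis comp_apply funpow_Suc_right)
    then show ?case
      by (subst Suc.IH) (simp only: sum.lessThan_Suc add.assoc)
  qed simp
  from this[of k] show ?thesis
    by (simp add: BB_0_power_Psi[OF assms] immaculate_replicate_0 immaculate_Cons immaculate_Nil BB_1)
qed

text \<open>Induction from the front: the extra \<open>BB (m + int k)\<close> of
  \<open>BB_mult_Psi\<close> is the summand for the first entry, and additivity of
  \<open>BB m\<close> carries the summands for the tail.\<close>

theorem immaculate_mult_Psi:
  assumes "k > 0"
  shows "immaculate g * Psi k = (\<Sum>j<length g. immaculate (g[j := g ! j + int k]))
    + (\<Sum>j<k. immaculate (g @ replicate j 0 @ [int k]))"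
proof (induction g)
  case Nil
  show ?case using Psi_eq_sum_immaculate[OF assms] by (simp add: immaculate_Nil)
next
  case (Cons m g)
  show ?case
    unfolding immaculate_Cons BB_mult_Psi[OF assms] Cons BB_add BB_sum length_Cons
      sum.lessThan_Suc_shift append_Cons
    by (simp add: immaculate_Cons)
qed

theorem theorem3p27:
  fixes \<alpha> :: composition and k :: nat
  assumes "k > 0"
  shows "immaculate (map int (parts \<alpha>)) * Psi k =
      (\<Sum>j < length (parts \<alpha>). immaculate (map int ((parts \<alpha>)[j := parts \<alpha> ! j + k])))
      + (\<Sum>j < k. immaculate (map int (parts \<alpha> @ replicate j 0 @ [k])))"
  using immaculate_mult_Psi[OF assms, of "map int (parts \<alpha>)"] by (simp add: map_update)

end
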